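(* Let $\{X_t\}_{t\in\mathbb{Z}}$ be a FIEGARCH$(p,d,q)$ process and let $\mathcal{F}_t:=\sigma(\{Z_s\}_{s\le t})$. Then the process $\{X_t\}_{t\in\mathbb{Z}}$ is a martingale difference with respect to $\{\mathcal{F}_t\}_{t\in\mathbb{Z}}$.
   Context: FIEGARCH$(p,d,q)$ process: let $\{Z_t\}_{t\in\mathbb{Z}}$ be a sequence of i.i.d. random variables with zero mean and variance equal to one. Let $\alpha(z)=1-\sum_{i=1}^p\alpha_iz^i$ and $\beta(z)=1-\sum_{j=1}^q\beta_jz^j$ be polynomials of orders $p$ and $q$ with no common roots and with $\beta(z)\neq0$ for $|z|\le1$. Then $\{X_t\}_{t\in\mathbb{Z}}$ is the stochastic process defined by $$X_t=\sigma_tZ_t,\qquad \ln(\sigma_t^2)=\omega+\frac{\alpha(\mathcal{B})}{\beta(\mathcal{B})}(1-\mathcal{B})^{-d}g(Z_{t-1}),\qquad\text{for all } t\in\mathbb{Z},$$ where $\omega\in\mathbb{R}$, $d\in\mathbb{R}$ (no further condition is imposed on $d$), $\mathcal{B}$ is the backward shift operator, $\mathcal{B}^k(X_t)=X_{t-k}$, and $g(Z_t)=\theta Z_t+\gamma\,[\,|Z_t|-\mathbb{E}(|Z_t|)\,]$ with $\theta,\gamma\in\mathbb{R}$. Equivalently, $\ln(\sigma_t^2)=\omega+\sum_{k=0}^\infty\lambda_{d,k}\,g(Z_{t-1-k})$, where $\lambda_{d,k}$ are the coefficients in $\frac{\alpha(z)}{\beta(z)}(1-z)^{-d}=\sum_{k=0}^\infty\lambda_{d,k}z^k$,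 $|z|<1$. $\sigma(\{Z_s\}_{s\le t})$ denotes the $\sigma$-field generated by $\{Z_s\}_{s\le t}$, and $\sigma_t$ is the positive square root of $\sigma_t^2$. "Martingale difference" has its usual meaning.
   Formalization: X_t need not be integrable (e.g. Student t(5) innovations, ln σ_t² = Z_{t-1}), so the usual martingale difference property is proved when all X_t are integrable; in general: adaptedness, E(|X_t| | F_{t-1}) < ∞ and E(X_t | F_{t-1}) = 0 a.s. in the extended sense. *)

theory Defs
  imports
    "HOL-Probability.Probability"
    "HOL-Computational_Algebra.Computational_Algebra"
begin

section \<open>FIEGARCH processes\<close>

definition lag_poly :: "nat \<Rightarrow> (nat \<Rightarrow> real) \<Rightarrow> real poly" where
  "lag_poly n c = 1 - (\<Sum>i=1..n. monom (c i) i)"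

text \<open>
  The coefficients of \<open>A(z) / B(z) * (1 - z) powr (-d)\<close>, computed in the ring of formal power
  series. Division is exact because a \<^const>\<open>lag_poly\<close> has constant term 1; the last factor is the binomial
  series of \<open>(1 + z) powr (-d)\<close> with \<open>-z\<close> substituted for \<open>z\<close>.
\<close>

definition fiegarch_coeff :: "real poly \<Rightarrow> real poly \<Rightarrow> real \<Rightarrow> nat \<Rightarrow> real" where
  "fiegarch_coeff A B d k =
     fps_nth (fps_of_poly A / fps_of_poly B * (fps_binomial (- d) oo (- fps_X))) k"

definition news_impact :: "'a measure \<Rightarrow> real \<Rightarrow> real \<Rightarrow> ('a \<Rightarrow> real) \<Rightarrow> 'a \<Rightarrow> real" where
  "news_impact M \<theta> \<gamma> W x = \<theta> * W x + \<gamma> * (\<bar>W x\<bar> - (\<integral>y. \<bar>W y\<bar> \<partial>M))"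

text \<open>
  The infinite moving average defining \<open>ln (\<sigma> t)\<^sup>2\<close> is required to converge almost surely; this is
  what it means for the defining equation to make sense, and the only way in which \<open>d\<close> is
  constrained. The defining equations hold at every sample point, so \<open>X\<close> and \<open>\<sigma>\<close> are genuine
  functions of the innovations and no completion of the filtration is needed. On the null set
  where the series diverges, the value of the sum is the fixed default of \<^const>\<open>suminf\<close>.
\<close>

locale fiegarch = prob_space M
  for M :: "'a measure"
    and p :: nat and d :: real and q :: nat
    and a b :: "nat \<Rightarrow> real"
    and \<omega> \<theta> \<gamma> :: real
    and Z \<sigma> X :: "int \<Rightarrow> 'a \<Rightarrow> real" +
  assumes Z_indep: "indep_vars (\<lambda>_. borel) Z UNIV"
    and Z_ident: "\<And>s t. distr M borel (Z s) = distr M borel (Z t)"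
    and Z_integrable: "\<And>t. integrable M (Z t)"
    and Z_square_integrable: "\<And>t. integrable M (\<lambda>x. (Z t x)\<^sup>2)"
    and Z_mean: "\<And>t. expectation (Z t) = 0"
    and Z_variance: "\<And>t. variance (Z t) = 1"
    and degree_alpha: "degree (lag_poly p a) = p"
    and degree_beta: "degree (lag_poly q b) = q"
    and no_common_roots:
      "\<And>z. \<not> (poly (map_poly complex_of_real (lag_poly p a)) z = 0 \<and>
               poly (map_poly complex_of_real (lag_poly q b)) z = 0)"
    and no_roots_in_disc:
      "\<And>z. norm z \<le> 1 \<Longrightarrow> poly (map_poly complex_of_real (lag_poly q b)) z \<noteq> 0"
    and series_converges:
      "\<And>t. AE x in M. summable (\<lambda>k. fiegarch_coeff (lag_poly p a) (lag_poly q b) d k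
                                       * news_impact M \<theta> \<gamma> (Z (t - 1 - int k)) x)"
    and sigma_pos: "\<And>t x. x \<in> space M \<Longrightarrow> \<sigma> t x > 0"
    and ln_sigma_square:
      "\<And>t x. x \<in> space M \<Longrightarrow>
         ln ((\<sigma> t x)\<^sup>2) =
           \<omega> + (\<Sum>k. fiegarch_coeff (lag_poly p a) (lag_poly q b) d k
                       * news_impact M \<theta> \<gamma> (Z (t - 1 - int k)) x)"
    and X_eq: "\<And>t x. x \<in> space M \<Longrightarrow> X t x = \<sigma> t x * Z t x"


section \<open>Martingale differences\<close>

definition past_sigma_field :: "'a measure \<Rightarrow> (int \<Rightarrow> 'a \<Rightarrow> real) \<Rightarrow> int \<Rightarrow> 'a measure" where
  "past_sigma_field M Z t =
     sigma (space M) {Z s -` S \<inter> space M | s S. s \<le> t \<and> S \<in> sets borel}"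

definition adapted_process ::
    "'a measure \<Rightarrow> (int \<Rightarrow> 'a measure) \<Rightarrow> (int \<Rightarrow> 'a \<Rightarrow> real) \<Rightarrow> bool" where
  "adapted_process M F X \<longleftrightarrow>
     (\<forall>t. subalgebra M (F t)) \<and>
     (\<forall>s t. s \<le> t \<longrightarrow> sets (F s) \<subseteq> sets (F t)) \<and>
     (\<forall>t. X t \<in> borel_measurable (F t))"

definition martingale_difference ::
    "'a measure \<Rightarrow> (int \<Rightarrow> 'a measure) \<Rightarrow> (int \<Rightarrow> 'a \<Rightarrow> real) \<Rightarrow> bool" where
  "martingale_difference M F X \<longleftrightarrow>
     adapted_process M F X \<and>
     (\<forall>t. integrable M (X t)) \<and>
     (\<forall>t. AE x in M. real_cond_exp M (F (t - 1)) (X t) x = 0)"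

text \<open>
  The conditional expectation of a random variable \<open>Y\<close> given \<open>G\<close> exists in the extended sense,
  as the difference of the conditional expectations of the positive and the negative part of
  \<open>Y\<close>, as soon as that of \<open>\<bar>Y\<bar>\<close> is almost surely finite; \<open>Y\<close> need not be integrable. This
  difference is how \<^const>\<open>real_cond_exp\<close> is defined. The moments of \<open>\<sigma> t\<close> are unrestricted in
  a FIEGARCH process, and \<open>X t\<close> may fail to be integrable: take \<open>p = q = 0\<close>, \<open>d = 0\<close>,
  \<open>\<theta> = 1\<close>, \<open>\<gamma> = 0\<close> and an innovation law for which \<open>exp (Z t / 2)\<close> is not integrable.
\<close>

definition generalized_martingale_difference ::
    "'a measure \<Rightarrow> (int \<Rightarrow> 'a measure) \<Rightarrow> (int \<Rightarrow> 'a \<Rightarrow> real) \<Rightarrow> bool" where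
  "generalized_martingale_difference M F X \<longleftrightarrow>
     adapted_process M F X \<and>
     (\<forall>t. AE x in M. nn_cond_exp M (F (t - 1)) (\<lambda>y. ennreal \<bar>X t y\<bar>) x < \<infinity>) \<and>
     (\<forall>t. AE x in M. real_cond_exp M (F (t - 1)) (X t) x = 0)"

end

theory Submission
  imports Defs
begin

text \<open>
  Every \<open>\<sigma> t\<close> is a Borel function of the innovations before time \<open>t\<close>, and \<open>Z t\<close> is independent of
  them. Hence the conditional expectations of the positive and the negative part of
  \<open>X t = \<sigma> t * Z t\<close> given the past are \<open>\<sigma> t\<close> times the expectations of the positive and the
  negative part of \<open>Z t\<close>. These are finite, and they agree because \<open>Z t\<close> has mean zero.
\<close>

lemma Int_stable_vimage: "Int_stable {Y -` S \<inter> \<Omega> | S. S \<in> sets N}"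
proof (rule Int_stableI, clarify)
  fix S T assume "S \<in> sets N" "T \<in> sets N"
  then show "\<exists>U. (Y -` S \<inter> \<Omega>) \<inter> (Y -` T \<inter> \<Omega>) = Y -` U \<inter> \<Omega> \<and> U \<in> sets N"
    by (intro exI[of _ "S \<inter> T"]) auto
qed

text \<open>Integrals over sets of \<open>F\<close> determine the conditional expectation. For
  \<open>A\<close> in \<open>F\<close> the indicator of \<open>A\<close> is independent of
  \<open>h (Y x)\<close>, so the integral of their product factors, exactly as it does for the
  constant.\<close>

lemma (in prob_space) nn_cond_exp_indep:
  assumes sub: "subalgebra M F"
    and Y[measurable]: "Y \<in> measurable M N"
    and indep: "indep_set (sets F) {Y -` B \<inter> space M | B. B \<in> sets N}"
    and h[measurable]: "h \<in> borel_measurable N"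
  shows "AE x in M. nn_cond_exp M F (\<lambda>x. h (Y x)) x = (\<integral>\<^sup>+y. h (Y y) \<partial>M)"
proof -
  interpret finite_measure_subalgebra M F
    using sub by unfold_locales
  have "AE x in M. (\<integral>\<^sup>+y. h (Y y) \<partial>M) = nn_cond_exp M F (\<lambda>x. h (Y x)) x"
  proof (rule nn_cond_exp_charact)
    fix A assume A[measurable]: "A \<in> sets F"
    then have AM[measurable]: "A \<in> sets M"
      using sub by (auto simp: subalgebra_def)
    let ?f = "indicator A :: 'a \<Rightarrow> ennreal"
    have "indep_var borel ?f borel (\<lambda>x. h (Y x))"
      unfolding indep_var_eq
    \<comment> \<open>Independence need only be checked on the preimage families, which are stable
      under intersection; they lie inside \<open>sets F\<close> and the preimages under
      \<open>Y\<close>.\<close>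
    proof (intro conjI indep_set_sigma_sets)
      have fF: "?f \<in> borel_measurable F" by measurable
      have "?f -` B \<inter> space M \<in> sets F" if "B \<in> sets borel" for B
        using measurable_sets[OF fF that] sub by (simp add: subalgebra_def)
      then have f: "{?f -` B \<inter> space M | B. B \<in> sets borel} \<subseteq> sets F"
        by blast
      have hY: "{(\<lambda>x. h (Y x)) -` B \<inter> space M | B. B \<in> sets borel}
          \<subseteq> {Y -` B \<inter> space M | B. B \<in> sets N}"
      proof clarify
        fix B :: "ennreal set" assume "B \<in> sets borel"
        then have "h -` B \<inter> space N \<in> sets N"
          by (rule measurable_sets[OF h])
        moreover have "(\<lambda>x. h (Y x)) -` B \<inter> space M = Y -` (h -` B \<inter> space N) \<inter> space M"
          using measurable_space[OF Y] by auto
        ultimately show "\<exists>C. (\<lambda>x. h (Y x)) -` B \<inter> space M = Y -` C \<inter> space M \<and> C \<in> sets N"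
          by blast
      qed
      show "indep_set {?f -` B \<inter> space M | B. B \<in> sets borel}
          {(\<lambda>x. h (Y x)) -` B \<inter> space M | B. B \<in> sets borel}"
        using indep unfolding indep_set_def
        by (rule indep_sets_mono_sets) (use f hY in \<open>simp split: bool.split\<close>)
    qed (auto intro: Int_stable_vimage)
    \<comment> \<open>The pair becomes a family indexed by the two truth values, so that the product
      formula for finite independent families applies.\<close>
    then have "indep_vars (\<lambda>_. borel) (case_bool ?f (\<lambda>x. h (Y x))) UNIV"
      unfolding indep_var_def by (simp add: case_bool_if)
    from indep_vars_nn_integral[OF _ this]
    have "(\<integral>\<^sup>+x. ?f x * h (Y x) \<partial>M) = (\<integral>\<^sup>+x. ?f x \<partial>M) * (\<integral>\<^sup>+x. h (Y x) \<partial>M)"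
      by (simp add: UNIV_bool mult.commute)
    then show "(\<integral>\<^sup>+x\<in>A. h (Y x) \<partial>M) = (\<integral>\<^sup>+x\<in>A. (\<integral>\<^sup>+y. h (Y y) \<partial>M) \<partial>M)"
      by (simp add: nn_integral_multc mult.commute[of _ "indicator A _"])
  qed auto
  then show ?thesis by eventually_elim simp
qed

text \<open>The factor known to \<open>F\<close> is pulled out and the independent one averages to a
  constant. Everything is nonnegative, so infinite values are allowed. The function \<open>k\<close>
  leaves room for absolute values and signed parts that factor only on
  \<open>space M\<close>.\<close>

lemma (in prob_space) nn_cond_exp_mult_indep:
  assumes sub: "subalgebra M F"
    and Y[measurable]: "Y \<in> measurable M N"
    and indep: "indep_set (sets F) {Y -` B \<inter> space M | B. B \<in> sets N}"
    and h[measurable]: "h \<in> borel_measurable N" and f: "f \<in> borel_measurable F"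
    and eq: "\<And>x. x \<in> space M \<Longrightarrow> k x = f x * h (Y x)"
  shows "AE x in M. nn_cond_exp M F k x = f x * (\<integral>\<^sup>+y. h (Y y) \<partial>M)"
proof -
  interpret finite_measure_subalgebra M F
    using sub by unfold_locales
  have [measurable]: "f \<in> borel_measurable M"
    by (rule measurable_from_subalg[OF sub f])
  have "k \<in> borel_measurable M \<longleftrightarrow> (\<lambda>x. f x * h (Y x)) \<in> borel_measurable M"
    by (rule measurable_cong) (rule eq)
  then have [measurable]: "k \<in> borel_measurable M" by simp
  have "AE x in M. nn_cond_exp M F k x = nn_cond_exp M F (\<lambda>x. f x * h (Y x)) x"
    by (rule nn_cond_exp_cong) (auto simp: eq)
  moreover have "AE x in M. f x * nn_cond_exp M F (\<lambda>x. h (Y x)) x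
      = nn_cond_exp M F (\<lambda>x. f x * h (Y x)) x"
    by (rule nn_cond_exp_prod[OF f]) auto
  ultimately show ?thesis
    using nn_cond_exp_indep[OF sub Y indep h] by eventually_elim simp
qed

text \<open>Since \<open>S\<close> is nonnegative, the absolute value and the positive and negative
  parts of \<open>W\<close> are \<open>S\<close> times those of \<open>Y\<close>; each is a separate
  use of the product rule.\<close>

lemma (in prob_space) cond_exp_mult_indep_mean_zero:
  fixes S Y W :: "'a \<Rightarrow> real"
  assumes sub: "subalgebra M F"
    and indep: "indep_set (sets F) {Y -` B \<inter> space M | B. B \<in> sets borel}"
    and int: "integrable M Y" and mean: "expectation Y = 0"
    and S[measurable]: "S \<in> borel_measurable F"
    and S_nonneg: "\<And>x. x \<in> space M \<Longrightarrow> 0 \<le> S x"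
    and W: "\<And>x. x \<in> space M \<Longrightarrow> W x = S x * Y x"
  shows "AE x in M. nn_cond_exp M F (\<lambda>y. ennreal \<bar>W y\<bar>) x < \<infinity>"
    and "AE x in M. real_cond_exp M F W x = 0"
proof -
  have Y: "Y \<in> borel_measurable M" using int by simp
  have "AE x in M. nn_cond_exp M F (\<lambda>y. ennreal \<bar>W y\<bar>) x
      = ennreal (S x) * (\<integral>\<^sup>+y. ennreal \<bar>Y y\<bar> \<partial>M)"
    by (rule nn_cond_exp_mult_indep[OF sub Y indep])
       (auto simp: W S_nonneg abs_mult ennreal_mult)
  moreover have "(\<integral>\<^sup>+y. ennreal \<bar>Y y\<bar> \<partial>M) < \<infinity>"
    using int by (simp add: integrable_iff_bounded)
  ultimately show "AE x in M. nn_cond_exp M F (\<lambda>y. ennreal \<bar>W y\<bar>) x < \<infinity>"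
    by (auto simp: ennreal_mult_less_top)
  \<comment> \<open>\<open>ennreal\<close> sends negative reals to 0, so
    \<open>ennreal (W y)\<close> is the positive part of \<open>W\<close> and
    \<open>ennreal (- W y)\<close> the negative part.\<close>
  have pos: "AE x in M. nn_cond_exp M F (\<lambda>y. ennreal (W y)) x
      = ennreal (S x) * (\<integral>\<^sup>+y. ennreal (Y y) \<partial>M)"
    by (rule nn_cond_exp_mult_indep[OF sub Y indep])
       (auto simp: W S_nonneg ennreal_mult')
  have neg: "AE x in M. nn_cond_exp M F (\<lambda>y. ennreal (- W y)) x
      = ennreal (S x) * (\<integral>\<^sup>+y. ennreal (- Y y) \<partial>M)"
  proof (rule nn_cond_exp_mult_indep[OF sub Y indep])
    show "ennreal (- W y) = ennreal (S y) * ennreal (- Y y)" if "y \<in> space M" for y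
      using W[OF that] ennreal_mult'[OF S_nonneg[OF that], of "- Y y"] by simp
  qed auto
  have "enn2real (\<integral>\<^sup>+y. ennreal (Y y) \<partial>M) = enn2real (\<integral>\<^sup>+y. ennreal (- Y y) \<partial>M)"
    using mean by (simp add: real_lebesgue_integral_def[OF int])
  with pos neg show "AE x in M. real_cond_exp M F W x = 0"
    unfolding real_cond_exp_def by (auto simp: enn2real_mult)
qed

text \<open>Groups the generators by time index, the form in which independence of disjoint blocks
  of indices is available.\<close>

lemma sets_past_sigma_field:
  "sets (past_sigma_field M Z t) =
     sigma_sets (space M) (\<Union>s\<in>{..t}. {Z s -` S \<inter> space M | S. S \<in> sets borel})"
  unfolding past_sigma_field_def
  by (subst sets_measure_of) (auto intro!: arg_cong[where f="sigma_sets _"])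

lemma space_past_sigma_field [simp]: "space (past_sigma_field M Z t) = space M"
  unfolding past_sigma_field_def by (rule space_measure_of) auto

lemma sets_past_sigma_field_mono:
  "s \<le> t \<Longrightarrow> sets (past_sigma_field M Z s) \<subseteq> sets (past_sigma_field M Z t)"
  unfolding sets_past_sigma_field by (intro sigma_sets_mono' UN_mono) auto

lemma measurable_past_sigma_field:
  assumes "s \<le> t"
  shows "Z s \<in> borel_measurable (past_sigma_field M Z t)"
  using assms by (intro measurableI) (auto simp: sets_past_sigma_field intro!: sigma_sets.Basic)

lemma subalgebra_past_sigma_field:
  assumes "\<And>s. Z s \<in> borel_measurable M"
  shows "subalgebra M (past_sigma_field M Z t)"
  unfolding subalgebra_def sets_past_sigma_field
  using assms by (auto intro!: sets.sigma_sets_subset measurable_sets)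

text \<open>The index blocks \<open>{..s}\<close> and \<open>{t}\<close> are disjoint, and disjoint
  blocks of an independent family of intersection-stable generators generate independent
  \<sigma>-fields.\<close>

lemma (in prob_space) indep_set_past_sigma_field:
  assumes Z: "indep_vars (\<lambda>_. borel) Z UNIV" and "s < t"
  shows "indep_set (sets (past_sigma_field M Z s)) {Z t -` S \<inter> space M | S. S \<in> sets borel}"
proof -
  let ?E = "\<lambda>i. {Z i -` S \<inter> space M | S. S \<in> sets borel}"
  have indep: "indep_sets ?E UNIV"
    using Z by (auto simp: indep_vars_def2)
  have "indep_sets (\<lambda>j. sigma_sets (space M) (\<Union>i\<in>case_bool {..s} {t} j. ?E i)) UNIV"
  proof (rule indep_sets_collect_sigma)
    show "indep_sets ?E (\<Union>j\<in>UNIV. case_bool {..s} {t} j)"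
      using indep by (rule indep_sets_mono_index[rotated]) simp
    show "disjoint_family_on (case_bool {..s} {t}) UNIV"
      using \<open>s < t\<close> by (auto simp: disjoint_family_on_def split: bool.splits)
  qed (rule Int_stable_vimage)
  \<comment> \<open>The second block is cut back from its generated \<sigma>-field to the bare
    preimages under \<open>Z t\<close>.\<close>
  then show ?thesis
    unfolding indep_set_def sets_past_sigma_field
    by (rule indep_sets_mono_sets) (auto split: bool.splits)
qed

context fiegarch
begin

lemma Z_measurable: "Z t \<in> borel_measurable M"
  using Z_indep by (auto simp: indep_vars_def2)

text \<open>The series involves only the innovations at times \<open>t - 1 - k\<close>, and
  positivity of \<open>\<sigma> t\<close> lets the logarithm be inverted at every sample point. The
  sum is measurable also across points of divergence, where \<open>suminf\<close> takes its
  default.\<close>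

lemma volatility_measurable_past: "\<sigma> t \<in> borel_measurable (past_sigma_field M Z (t - 1))"
proof -
  let ?L = "\<lambda>x. \<omega> + (\<Sum>k. fiegarch_coeff (lag_poly p a) (lag_poly q b) d k
                       * news_impact M \<theta> \<gamma> (Z (t - 1 - int k)) x)"
  have Z[measurable]: "Z (t - 1 - int k) \<in> borel_measurable (past_sigma_field M Z (t - 1))" for k
    by (rule measurable_past_sigma_field) simp
  have "(\<lambda>x. exp (?L x / 2)) \<in> borel_measurable (past_sigma_field M Z (t - 1))"
    unfolding news_impact_def by measurable
  moreover have "\<sigma> t x = exp (?L x / 2)" if "x \<in> space M" for x
  proof -
    have "?L x = 2 * ln (\<sigma> t x)"
      using ln_sigma_square[OF that, of t] sigma_pos[OF that, of t] by (simp add: ln_realpow)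
    then show ?thesis
      using sigma_pos[OF that, of t] by simp
  qed
  ultimately show ?thesis
    by (subst measurable_cong) auto
qed

lemma adapted: "adapted_process M (past_sigma_field M Z) X"
  unfolding adapted_process_def
proof (intro conjI allI impI)
  fix t
  have [measurable]: "Z t \<in> borel_measurable (past_sigma_field M Z t)"
    by (rule measurable_past_sigma_field) simp
  \<comment> \<open>The volatility is known one step earlier than \<open>Z t\<close>; its
    measurability is carried up to time \<open>t\<close>.\<close>
  have "subalgebra (past_sigma_field M Z t) (past_sigma_field M Z (t - 1))"
    by (simp add: subalgebra_def sets_past_sigma_field_mono)
  from measurable_from_subalg[OF this volatility_measurable_past]
  have [measurable]: "\<sigma> t \<in> borel_measurable (past_sigma_field M Z t)" .
  have "(\<lambda>x. \<sigma> t x * Z t x) \<in> borel_measurable (past_sigma_field M Z t)" by simp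
  then show "X t \<in> borel_measurable (past_sigma_field M Z t)"
    by (subst measurable_cong[OF X_eq]) auto
qed (auto simp: subalgebra_past_sigma_field Z_measurable dest: sets_past_sigma_field_mono)

lemma
  shows nn_cond_exp_finite:
      "AE x in M. nn_cond_exp M (past_sigma_field M Z (t - 1)) (\<lambda>y. ennreal \<bar>X t y\<bar>) x < \<infinity>"
    and real_cond_exp_zero:
      "AE x in M. real_cond_exp M (past_sigma_field M Z (t - 1)) (X t) x = 0"
proof -
  have sub: "subalgebra M (past_sigma_field M Z (t - 1))"
    by (rule subalgebra_past_sigma_field) (rule Z_measurable)
  have indep: "indep_set (sets (past_sigma_field M Z (t - 1))) {Z t -` S \<inter> space M | S. S \<in> sets borel}"
    by (rule indep_set_past_sigma_field[OF Z_indep]) simp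
  note cond = cond_exp_mult_indep_mean_zero[OF sub indep Z_integrable Z_mean
      volatility_measurable_past less_imp_le[OF sigma_pos] X_eq]
  show "AE x in M. nn_cond_exp M (past_sigma_field M Z (t - 1)) (\<lambda>y. ennreal \<bar>X t y\<bar>) x < \<infinity>"
    by (rule cond)
  show "AE x in M. real_cond_exp M (past_sigma_field M Z (t - 1)) (X t) x = 0"
    by (rule cond)
qed

end

text \<open>Integrability of \<open>X t\<close> is the one clause of the usual notion that can fail
  here, so it appears as a premise of the second conjunct only.\<close>

theorem lemma1:
  fixes M :: "'a measure"
    and p :: nat and d :: real and q :: nat
    and a b :: "nat \<Rightarrow> real"
    and \<omega> \<theta> \<gamma> :: real
    and Z \<sigma> X :: "int \<Rightarrow> 'a \<Rightarrow> real"
  assumes "fiegarch M p d q a b \<omega> \<theta> \<gamma> Z \<sigma> X"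
  shows "generalized_martingale_difference M (past_sigma_field M Z) X \<and>
         ((\<forall>t. integrable M (X t)) \<longrightarrow> martingale_difference M (past_sigma_field M Z) X)"
proof -
  interpret fiegarch M p d q a b \<omega> \<theta> \<gamma> Z \<sigma> X by fact
  show ?thesis
    unfolding generalized_martingale_difference_def martingale_difference_def
    using adapted nn_cond_exp_finite real_cond_exp_zero by blast
qed

end
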